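(* For every $\delta\in(0,1]$, $$\mathfrak F_{\mathrm{EFX}^+}(\delta)\ge\max\{\delta,1/2\}.$$ Moreover, $\mathfrak F_{\mathrm{EFX}^+}(1)=1$.
   Context: Instance: firms $F=\{1,\dots,m\}$, workers $W=\{1,\dots,n\}$ ($m,n$ arbitrary), values $A=(a_{ij})$ with $a_{ij}\ge 0$, additive: $V_i(T)=\sum_{j\in T}a_{ij}$. A complete matching $X=(X_1,\dots,X_m)$ is a partition of $W$ (parts may be empty). $M_j=\max_i a_{ij}$. If some $a_{ij}>0$, $\delta(A)=\min_{a_{ij}>0}a_{ij}/M_j$; for the all-zero market $\delta(A)=1$. For $\gamma\in[0,1]$, $X$ is $\gamma$-$\mathrm{EFX}^+$ if for every pair of firms $i,k$ and every $g\in X_k$ with $a_{ig}>0$, $V_i(X_i)\ge\gamma V_i(X_k\setminus\{g\})$. Core: profits $x_i\ge 0$ and wages $y_j\ge 0$ satisfy local financing if $x_i+\sum_{j\in X_i}y_j=V_i(X_i)$ for all $i$. $(X,x,y)$ is in the $\alpha$-core if $\sum_{i\in I}x_i+\sum_{j\in T}y_j\ge\alpha\sum_{j\in T}\max_{i\in I}a_{ij}$ for all nonempty $I\subseteq F$ and all $T\subseteq W$. $\alpha(X)$ is the largest $\alpha$ (supremum in $[0,+\infty]$) for which some nonnegative $x,y$ satisfying local financing make $(X,x,y)$ an element of the $\alpha$-core. Definition: $\mathfrak F_{\mathrm{EFX}^+}(\delta)=\inf_{A:\,\delta(A)\ge\delta}\ \max_{X:\,\alpha(X)\ge\delta}\ \sup\{\gamma\in[0,1]:X\text{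 is }\gamma\text{-}\mathrm{EFX}^+\}$, the infimum being over all instances $A$ with $\delta(A)\ge\delta$ and the maximum over complete matchings $X$ of the instance with $\alpha(X)\ge\delta$. *)

theory Defs
  imports Complex_Main "HOL-Library.FuncSet" "HOL-Library.Disjoint_Sets"
    "HOL-Library.Extended_Nonnegative_Real"
begin

text \<open>
  An instance is a triple \<open>m\<close>, \<open>n\<close>, \<open>a\<close> with firms \<open>{1..m}\<close>, workers \<open>{1..n}\<close> and values \<open>a i j\<close>;
  entries of \<open>a\<close> outside \<open>{1..m} \<times> {1..n}\<close> play no role.  At least one firm is required, since
  otherwise the column maxima do not exist; \<open>n = 0\<close> is allowed.
\<close>

definition market :: "nat \<Rightarrow> nat \<Rightarrow> (nat \<Rightarrow> nat \<Rightarrow> real) \<Rightarrow> bool" where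
  "market m n a \<longleftrightarrow> 1 \<le> m \<and> (\<forall>i\<in>{1..m}. \<forall>j\<in>{1..n}. 0 \<le> a i j)"

definition val :: "(nat \<Rightarrow> nat \<Rightarrow> real) \<Rightarrow> nat \<Rightarrow> nat set \<Rightarrow> real" where
  "val a i T = (\<Sum>j\<in>T. a i j)"

definition col_max :: "(nat \<Rightarrow> nat \<Rightarrow> real) \<Rightarrow> nat set \<Rightarrow> nat \<Rightarrow> real" where
  "col_max a I j = Max ((\<lambda>i. a i j) ` I)"

definition market_delta :: "nat \<Rightarrow> nat \<Rightarrow> (nat \<Rightarrow> nat \<Rightarrow> real) \<Rightarrow> real" where
  "market_delta m n a =
     (if \<exists>i\<in>{1..m}. \<exists>j\<in>{1..n}. 0 < a i j
      then Min {a i j / col_max a {1..m} j | i j. i \<in> {1..m} \<and> j \<in> {1..n} \<and> 0 < a i j}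
      else 1)"

text \<open>
  Parts may be empty.  Matchings are extensional functions on the firms, so each instance has
  only finitely many of them.
\<close>

definition complete_matching :: "nat \<Rightarrow> nat \<Rightarrow> (nat \<Rightarrow> nat set) \<Rightarrow> bool" where
  "complete_matching m n X \<longleftrightarrow>
     X \<in> {1..m} \<rightarrow>\<^sub>E Pow {1..n} \<and> disjoint_family_on X {1..m} \<and> (\<Union>i\<in>{1..m}. X i) = {1..n}"

definition EFX_plus :: "nat \<Rightarrow> (nat \<Rightarrow> nat \<Rightarrow> real) \<Rightarrow> real \<Rightarrow> (nat \<Rightarrow> nat set) \<Rightarrow> bool" where
  "EFX_plus m a \<gamma> X \<longleftrightarrow>
     (\<forall>i\<in>{1..m}. \<forall>k\<in>{1..m}. \<forall>g\<in>X k. 0 < a i g \<longrightarrow> val a i (X i) \<ge> \<gamma> * val a i (X k - {g}))"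

definition EFX_plus_level :: "nat \<Rightarrow> (nat \<Rightarrow> nat \<Rightarrow> real) \<Rightarrow> (nat \<Rightarrow> nat set) \<Rightarrow> real" where
  "EFX_plus_level m a X = Sup {\<gamma> \<in> {0..1}. EFX_plus m a \<gamma> X}"

definition locally_financed ::
  "nat \<Rightarrow> (nat \<Rightarrow> nat \<Rightarrow> real) \<Rightarrow> (nat \<Rightarrow> nat set) \<Rightarrow> (nat \<Rightarrow> real) \<Rightarrow> (nat \<Rightarrow> real) \<Rightarrow> bool" where
  "locally_financed m a X x y \<longleftrightarrow> (\<forall>i\<in>{1..m}. x i + (\<Sum>j\<in>X i. y j) = val a i (X i))"

definition in_core ::
  "nat \<Rightarrow> nat \<Rightarrow> (nat \<Rightarrow> nat \<Rightarrow> real) \<Rightarrow> real \<Rightarrow> (nat \<Rightarrow> nat set) \<Rightarrow> (nat \<Rightarrow> real) \<Rightarrow> (nat \<Rightarrow> real) \<Rightarrow> bool" where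
  "in_core m n a \<alpha> X x y \<longleftrightarrow>
     (\<forall>i\<in>{1..m}. 0 \<le> x i) \<and> (\<forall>j\<in>{1..n}. 0 \<le> y j) \<and> locally_financed m a X x y \<and>
     (\<forall>I T. I \<noteq> {} \<and> I \<subseteq> {1..m} \<and> T \<subseteq> {1..n} \<longrightarrow>
        (\<Sum>i\<in>I. x i) + (\<Sum>j\<in>T. y j) \<ge> \<alpha> * (\<Sum>j\<in>T. col_max a I j))"

definition core_level :: "nat \<Rightarrow> nat \<Rightarrow> (nat \<Rightarrow> nat \<Rightarrow> real) \<Rightarrow> (nat \<Rightarrow> nat set) \<Rightarrow> ennreal" where
  "core_level m n a X = (SUP \<alpha>\<in>{\<alpha>::real. 0 \<le> \<alpha> \<and> (\<exists>x y. in_core m n a \<alpha> X x y)}. ennreal \<alpha>)"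

text \<open>
  For \<open>0 < \<delta> \<le> 1\<close> all extrema below are over admissible sets.  \<open>Max\<close> is over a finite set, which
  is nonempty: giving each worker \<open>j\<close> to a firm that values it most, with zero profits and with
  the wage of \<open>j\<close> equal to its column maximum, yields an element of the 1-core.  \<open>Inf\<close> is over a
  subset of \<open>[0,1]\<close>, nonempty because of the all-zero market.
\<close>

definition frontier_EFX_plus :: "real \<Rightarrow> real" where
  "frontier_EFX_plus \<delta> =
     Inf {Max (EFX_plus_level m a ` {X. complete_matching m n X \<and> ennreal \<delta> \<le> core_level m n a X})
          | m n a. market m n a \<and> \<delta> \<le> market_delta m n a}"

end

theory Submission
  imports Defs
begin

text \<open>
  Call an assignment of workers to firms supported if no worker with a positive column maximum
  works for a firm that values it at 0.  With zero profits, and every wage equal to the value of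
  the worker to its firm, a supported matching lies in the \<open>\<delta>\<close>-core.  It remains to find supported
  matchings that are fair.

  For the bound \<open>\<delta>\<close>, replace every positive value by the column maximum.  Among the supported
  assignments take one with the least sum of squares of the firms' loads: if firm \<open>i\<close> envied
  \<open>k\<close> after the removal of a worker \<open>g\<close> that \<open>i\<close> values, moving \<open>g\<close> to \<open>i\<close> would decrease that sum.
  Returning to the original values costs a factor \<open>\<delta>\<close>.

  For the bound \<open>1/2\<close>, take a partial \<open>1/2\<close>-EFX+ assignment of the largest welfare, and drop
  workers from firms that do not value them.  Suppose a worker \<open>g\<close> valued by the firms in
  \<open>L \<noteq> {}\<close> is unassigned.  An envy cycle within \<open>L\<close> could be rotated, so some \<open>k \<in> L\<close> is not envied
  within \<open>L\<close>.  If a firm of \<open>L\<close> prefers \<open>g\<close> alone to its part, it can exchange its part for \<open>{g}\<close>;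
  otherwise \<open>g\<close> can be given to \<open>k\<close>, since firms outside \<open>L\<close> do not notice \<open>g\<close>.  In each case the
  welfare increases, a contradiction.
\<close>

section \<open>Assignments of workers to firms\<close>

text \<open>Coding a matching by the firm of each worker makes the parts disjoint automatically, and
  moving a worker becomes a function update.\<close>

definition part :: "nat \<Rightarrow> (nat \<Rightarrow> nat) \<Rightarrow> nat \<Rightarrow> nat set" where
  "part n \<sigma> i = {j \<in> {1..n}. \<sigma> j = i}"

definition supported :: "nat \<Rightarrow> nat \<Rightarrow> (nat \<Rightarrow> nat \<Rightarrow> real) \<Rightarrow> (nat \<Rightarrow> nat) \<Rightarrow> bool" where
  "supported m n a \<sigma> \<longleftrightarrow>
     \<sigma> \<in> {1..n} \<rightarrow> {1..m} \<and> (\<forall>j\<in>{1..n}. \<forall>i\<in>{1..m}. 0 < a i j \<longrightarrow> 0 < a (\<sigma> j) j)"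

lemma finite_part [simp]: "finite (part n \<sigma> i)"
  by (simp add: part_def)

lemma part_subset: "part n \<sigma> i \<subseteq> {1..n}"
  by (auto simp: part_def)

text \<open>Only the values on the workers matter, so an extremal assignment can be sought among
  finitely many extensional functions and still be compared with arbitrary ones.\<close>

lemma part_restrict [simp]: "part n (restrict \<sigma> {Suc 0..n}) = part n \<sigma>"
  by (auto simp: part_def fun_eq_iff)

lemma supported_restrict [simp]: "supported m n a (restrict \<sigma> {Suc 0..n}) \<longleftrightarrow> supported m n a \<sigma>"
  by (auto simp: supported_def Pi_iff)

lemma market_nonneg: "market m n a \<Longrightarrow> i \<in> {1..m} \<Longrightarrow> j \<in> {1..n} \<Longrightarrow> 0 \<le> a i j"
  by (simp add: market_def)

lemma val_mono:
  assumes "market m n a" "i \<in> {1..m}" "S \<subseteq> T" "T \<subseteq> {1..n}"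
  shows "val a i S \<le> val a i T"
  unfolding val_def
proof (rule sum_mono2)
  show "finite T" using assms(4) by (rule finite_subset) simp
  show "0 \<le> a i j" if "j \<in> T - S" for j
    using that assms market_nonneg by blast
qed (fact assms(3))

lemma val_nonneg:
  assumes "market m n a" "i \<in> {1..m}" "T \<subseteq> {1..n}"
  shows "0 \<le> val a i T"
  using val_mono[OF assms(1,2) _ assms(3), of "{}"] by (simp add: val_def)

lemma col_max_ge: "finite I \<Longrightarrow> i \<in> I \<Longrightarrow> a i j \<le> col_max a I j"
  by (simp add: col_max_def)

lemma col_max_mono: "finite J \<Longrightarrow> I \<subseteq> J \<Longrightarrow> I \<noteq> {} \<Longrightarrow> col_max a I j \<le> col_max a J j"
  unfolding col_max_def by (intro Max_mono) auto

lemma col_max_attained: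
  assumes "finite I" "I \<noteq> {}"
  obtains i where "i \<in> I" "a i j = col_max a I j"
proof -
  have "col_max a I j \<in> (\<lambda>i. a i j) ` I"
    unfolding col_max_def using assms by (intro Max_in) auto
  then show thesis using that by auto
qed

section \<open>The market parameter and the core\<close>

lemma market_delta_bound:
  assumes "\<delta> \<le> market_delta m n a" "i \<in> {1..m}" "j \<in> {1..n}" "0 < a i j"
  shows "\<delta> * col_max a {1..m} j \<le> a i j"
proof -
  let ?S = "{a i j / col_max a {1..m} j | i j. i \<in> {1..m} \<and> j \<in> {1..n} \<and> 0 < a i j}"
  have "?S \<subseteq> (\<lambda>(i,j). a i j / col_max a {1..m} j) ` ({1..m} \<times> {1..n})"
    by auto
  then have "finite ?S" by (rule finite_subset) simp
  moreover have "a i j / col_max a {1..m} j \<in> ?S" using assms by blast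
  ultimately have "Min ?S \<le> a i j / col_max a {1..m} j" by (rule Min_le)
  moreover have "market_delta m n a = Min ?S"
    unfolding market_delta_def using assms by auto
  moreover have "0 < col_max a {1..m} j"
    using col_max_ge[of "{1..m}" i a j] assms by simp
  ultimately show ?thesis using assms(1) by (metis order_trans pos_le_divide_eq)
qed

text \<open>If some firm values \<open>j\<close>, support makes the entry at
  \<open>\<sigma> j\<close> positive and the bound on positive entries applies; otherwise the column
  maximum is 0.\<close>

lemma supported_bound:
  assumes "market m n a" "\<delta> \<le> market_delta m n a" "supported m n a \<sigma>" "j \<in> {1..n}"
  shows "\<delta> * col_max a {1..m} j \<le> a (\<sigma> j) j"
proof -
  have s: "\<sigma> j \<in> {1..m}" using assms unfolding supported_def by blast
  have ne: "{1..m} \<noteq> {}" using assms(1) by (auto simp: market_def)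
  obtain i where i: "i \<in> {1..m}" "a i j = col_max a {1..m} j"
    using col_max_attained[OF _ ne] by blast
  show ?thesis
  proof (cases "0 < a i j")
    case True
    then have "0 < a (\<sigma> j) j" using assms i unfolding supported_def by blast
    then show ?thesis using market_delta_bound assms s by blast
  next
    case False
    then have "a i j = 0" using market_nonneg[OF assms(1) i(1) assms(4)] by simp
    then show ?thesis using i market_nonneg[OF assms(1) s assms(4)] by simp
  qed
qed

lemma complete_matching_part:
  assumes "\<sigma> \<in> {1..n} \<rightarrow> {1..m}"
  shows "complete_matching m n (restrict (part n \<sigma>) {1..m})"
  using assms unfolding complete_matching_def part_def disjoint_family_on_def by (auto simp: Pi_iff)

lemma supported_core_level:
  assumes mk: "market m n a" and d: "\<delta> \<le> market_delta m n a" "0 < \<delta>"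
    and s: "supported m n a \<sigma>"
  shows "ennreal \<delta> \<le> core_level m n a (restrict (part n \<sigma>) {1..m})"
proof -
  let ?y = "\<lambda>j. a (\<sigma> j) j"
  have sr: "\<sigma> j \<in> {1..m}" if "j \<in> {1..n}" for j
    using s that unfolding supported_def by blast
  have "in_core m n a \<delta> (restrict (part n \<sigma>) {1..m}) (\<lambda>_. 0) ?y"
    unfolding in_core_def locally_financed_def
  proof (intro conjI ballI allI impI)
    show "0 \<le> ?y j" if "j \<in> {1..n}" for j
      using market_nonneg[OF mk sr[OF that] that] .
    show "0 + (\<Sum>j\<in>restrict (part n \<sigma>) {1..m} i. ?y j) = val a i (restrict (part n \<sigma>) {1..m} i)"
      if "i \<in> {1..m}" for i
      using that by (auto simp: val_def part_def intro!: sum.cong)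
    show "\<delta> * (\<Sum>j\<in>T. col_max a I j) \<le> (\<Sum>i\<in>I. 0) + (\<Sum>j\<in>T. ?y j)"
      if IT: "I \<noteq> {} \<and> I \<subseteq> {1..m} \<and> T \<subseteq> {1..n}" for I T
    proof -
      \<comment> \<open>A coalition's maximum is at most the maximum over all firms, so the wages
        alone already pay for \<open>T\<close>.\<close>
      have "\<delta> * col_max a I j \<le> ?y j" if "j \<in> T" for j
      proof -
        have "col_max a I j \<le> col_max a {1..m} j" using IT by (intro col_max_mono) auto
        then have "\<delta> * col_max a I j \<le> \<delta> * col_max a {1..m} j" using d by simp
        also have "\<dots> \<le> ?y j" using supported_bound[OF mk d(1) s] IT that by blast
        finally show ?thesis .
      qed
      then show ?thesis by (simp add: sum_distrib_left sum_mono)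
    qed
  qed simp
  then show ?thesis unfolding core_level_def using d(2) by (intro SUP_upper) auto
qed

lemma finite_complete_matchings: "finite {X. complete_matching m n X}"
  by (rule finite_subset[of _ "{1..m} \<rightarrow>\<^sub>E Pow {1..n}"])
    (auto simp: complete_matching_def intro!: finite_PiE)

lemma EFX_plus_level_ge: "\<gamma> \<in> {0..1} \<Longrightarrow> EFX_plus m a \<gamma> X \<Longrightarrow> \<gamma> \<le> EFX_plus_level m a X"
  unfolding EFX_plus_level_def by (intro cSup_upper bdd_aboveI[of _ 1]) auto

text \<open>Reduces each bound to the search for a fair supported assignment: the matching it
  induces is admissible in the maximum, which is over a finite set.\<close>

lemma supported_le_Max:
  assumes "market m n a" "\<delta> \<le> market_delta m n a" "0 < \<delta>" "supported m n a \<sigma>"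
    and "\<gamma> \<in> {0..1}" "EFX_plus m a \<gamma> (part n \<sigma>)"
  shows "\<gamma> \<le> Max (EFX_plus_level m a ` {X. complete_matching m n X \<and> ennreal \<delta> \<le> core_level m n a X})"
proof -
  let ?X = "restrict (part n \<sigma>) {1..m}"
  have "complete_matching m n ?X"
    using assms(4) by (intro complete_matching_part) (simp add: supported_def)
  moreover have "ennreal \<delta> \<le> core_level m n a ?X"
    using assms(1-4) by (rule supported_core_level)
  moreover have "EFX_plus m a \<gamma> ?X" using assms(6) by (simp add: EFX_plus_def)
  ultimately show ?thesis
    using EFX_plus_level_ge[OF assms(5), of m a ?X]
      finite_subset[OF _ finite_complete_matchings, of "{X. complete_matching m n X \<and> ennreal \<delta> \<le> core_level m n a X}"]
    by (subst Max_ge_iff) auto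
qed

section \<open>The bound \<delta> by balancing loads\<close>

lemma ex_supported_EFX_plus_delta:
  assumes mk: "market m n a" and d: "\<delta> \<le> market_delta m n a" "0 < \<delta>" "\<delta> \<le> 1"
  shows "\<exists>\<sigma>. supported m n a \<sigma> \<and> EFX_plus m a \<delta> (part n \<sigma>)"
proof -
  \<comment> \<open>All firms now weigh worker \<open>j\<close> alike, by \<open>M j\<close>, and
    \<open>\<Phi>\<close> is small when the loads \<open>W\<close> are balanced.\<close>
  define M where "M = col_max a {1..m}"
  define W where "W \<sigma> i = (\<Sum>j\<in>part n \<sigma> i. M j)" for \<sigma> i
  define \<Phi> where "\<Phi> \<sigma> = (\<Sum>i\<in>{1..m}. (W \<sigma> i)\<^sup>2)" for \<sigma>
  define S where "S = {\<sigma> \<in> {1..n} \<rightarrow>\<^sub>E {1..m}. supported m n a \<sigma>}"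
  have ne: "{1..m} \<noteq> {}" using mk by (auto simp: market_def)
  have aM: "a i j \<le> M j" if "i \<in> {1..m}" for i j
    unfolding M_def using that by (intro col_max_ge) auto
  have "\<forall>j. \<exists>i. i \<in> {1..m} \<and> a i j = M j"
    using col_max_attained[OF _ ne] unfolding M_def by blast
  then obtain s where s: "\<And>j. s j \<in> {1..m}" "\<And>j. a (s j) j = M j" by metis
  \<comment> \<open>Choosing for each worker a firm that values it most shows that \<open>S\<close>
    is nonempty.\<close>
  have "supported m n a s"
    unfolding supported_def using s aM by (auto intro: less_le_trans)
  then have "restrict s {1..n} \<in> S" using s unfolding S_def by auto
  moreover have "finite S"
    unfolding S_def by (rule finite_subset[of _ "{1..n} \<rightarrow>\<^sub>E {1..m}"]) (auto intro!: finite_PiE)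
  ultimately obtain \<sigma> where \<sigma>: "\<sigma> \<in> S" "\<And>\<tau>. \<tau> \<in> S \<Longrightarrow> \<Phi> \<sigma> \<le> \<Phi> \<tau>"
    using arg_min_if_finite(1)[of S \<Phi>] arg_min_least[of S _ \<Phi>] by (metis empty_iff)
  have sup: "supported m n a \<sigma>" using \<sigma>(1) by (simp add: S_def)
  have min: "\<Phi> \<sigma> \<le> \<Phi> \<tau>" if "supported m n a \<tau>" for \<tau>
  proof -
    have "restrict \<tau> {1..n} \<in> S" using that unfolding S_def by (auto simp: supported_def)
    from \<sigma>(2)[OF this] show ?thesis by (simp add: \<Phi>_def W_def)
  qed
  have "EFX_plus m a \<delta> (part n \<sigma>)"
    unfolding EFX_plus_def
  proof (intro ballI impI, rule ccontr)
    fix i k g assume i: "i \<in> {1..m}" and k: "k \<in> {1..m}" and g: "g \<in> part n \<sigma> k"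
      and pos: "0 < a i g" and "\<not> \<delta> * val a i (part n \<sigma> k - {g}) \<le> val a i (part n \<sigma> i)"
    then have envy: "val a i (part n \<sigma> i) < \<delta> * val a i (part n \<sigma> k - {g})" by simp
    have g': "g \<in> {1..n}" "\<sigma> g = k" using g by (auto simp: part_def)
    \<comment> \<open>EFX+ also compares a firm with itself; that comparison holds because \<delta>
      \<le> 1.\<close>
    have "i \<noteq> k"
    proof
      assume "i = k"
      have "\<delta> * val a i (part n \<sigma> k - {g}) \<le> val a i (part n \<sigma> k - {g})"
        using val_nonneg[OF mk i, of "part n \<sigma> k - {g}"] part_subset[of n \<sigma> k] d
        by (intro mult_left_le_one_le) auto
      also have "\<dots> \<le> val a i (part n \<sigma> k)"
        using part_subset by (intro val_mono[OF mk i]) auto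
      finally show False using envy \<open>i = k\<close> by simp
    qed
    \<comment> \<open>Pass from values to weights: support gives
      \<open>\<delta> * M j \<le> a i j\<close> on the own part of \<open>i\<close>,
      \<open>a i j \<le> M j\<close> bounds the envied part, and the factor \<delta>
      cancels.\<close>
    have "\<delta> * W \<sigma> i \<le> val a i (part n \<sigma> i)"
      unfolding W_def val_def sum_distrib_left
    proof (rule sum_mono)
      fix j assume "j \<in> part n \<sigma> i"
      then show "\<delta> * M j \<le> a i j"
        using supported_bound[OF mk d(1) sup, of j] by (auto simp: part_def M_def)
    qed
    also note envy
    also have "\<delta> * val a i (part n \<sigma> k - {g}) \<le> \<delta> * (\<Sum>j\<in>part n \<sigma> k - {g}. M j)"
      unfolding val_def using d i aM by (intro mult_left_mono sum_mono) auto
    also have "(\<Sum>j\<in>part n \<sigma> k - {g}. M j) = W \<sigma> k - M g"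
      unfolding W_def using g by (simp add: sum_diff1)
    finally have lt: "W \<sigma> i < W \<sigma> k - M g" using d by simp
    have Mg: "0 < M g" using aM[OF i, of g] pos by simp
    define \<tau> where "\<tau> = \<sigma>(g := i)"
    have "supported m n a \<tau>"
      using sup i pos unfolding supported_def \<tau>_def by (auto simp: Pi_iff)
    then have "\<Phi> \<sigma> \<le> \<Phi> \<tau>" by (rule min)
    have pi: "part n \<tau> i = insert g (part n \<sigma> i)" "g \<notin> part n \<sigma> i"
      using g' \<open>i \<noteq> k\<close> by (auto simp: part_def \<tau>_def)
    have pk: "part n \<tau> k = part n \<sigma> k - {g}"
      using g' \<open>i \<noteq> k\<close> by (auto simp: part_def \<tau>_def)
    have po: "part n \<tau> l = part n \<sigma> l" if "l \<noteq> i" "l \<noteq> k" for l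
      using g' that by (auto simp: part_def \<tau>_def)
    have Wi: "W \<tau> i = W \<sigma> i + M g" unfolding W_def pi(1) using pi(2) by simp
    have Wk: "W \<tau> k = W \<sigma> k - M g" unfolding W_def pk using g by (simp add: sum_diff1)
    have split: "\<Phi> \<rho> = (W \<rho> i)\<^sup>2 + (W \<rho> k)\<^sup>2 + (\<Sum>l\<in>{1..m} - {i} - {k}. (W \<rho> l)\<^sup>2)" for \<rho>
      unfolding \<Phi>_def using i k \<open>i \<noteq> k\<close>
      by (subst sum.remove[of _ i], simp, simp, subst sum.remove[of _ k]) auto
    have "(\<Sum>l\<in>{1..m} - {i} - {k}. (W \<tau> l)\<^sup>2) = (\<Sum>l\<in>{1..m} - {i} - {k}. (W \<sigma> l)\<^sup>2)"
      by (intro sum.cong) (auto simp: W_def po)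
    \<comment> \<open>The gap between the two loads exceeds \<open>M g\<close>, so moving the
      positive weight \<open>M g\<close> to the lighter one lowers the sum of squares
      strictly.\<close>
    then have "\<Phi> \<tau> - \<Phi> \<sigma> = 2 * (M g * (W \<sigma> i - (W \<sigma> k - M g)))"
      unfolding split Wi Wk by (simp add: power2_eq_square algebra_simps)
    moreover have "M g * (W \<sigma> i - (W \<sigma> k - M g)) < 0"
      using Mg lt by (intro mult_pos_neg) auto
    ultimately show False using \<open>\<Phi> \<sigma> \<le> \<Phi> \<tau>\<close> by simp
  qed
  with sup show ?thesis by blast
qed

section \<open>The bound 1/2 by maximizing welfare\<close>

text \<open>A smallest nonempty subset that \<open>f\<close> maps into itself is mapped onto itself,
  hence bijectively by finiteness. With \<open>f k\<close> a firm envying \<open>k\<close>, this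
  yields envy cycles that can be rotated simultaneously.\<close>

lemma ex_bij_betw_subset:
  assumes "finite S" "S \<noteq> {}" "f ` S \<subseteq> S"
  obtains C where "C \<subseteq> S" "C \<noteq> {}" "bij_betw f C C"
proof -
  let ?P = "\<lambda>C. C \<subseteq> S \<and> C \<noteq> {} \<and> f ` C \<subseteq> C"
  have "?P S" using assms by blast
  then obtain C where C: "?P C" "\<And>D. ?P D \<Longrightarrow> card C \<le> card D"
    using ex_has_least_nat[of ?P S card] by blast
  have fin: "finite C" using C(1) assms(1) finite_subset by blast
  have "?P (f ` C)" using C(1) by blast
  then have "f ` C = C"
    using C(1) C(2)[of "f ` C"] card_image_le[OF fin, of f] fin
    by (intro card_subset_eq) (auto intro: le_antisym)
  then have "bij_betw f C C"
    using fin by (simp add: bij_betw_def eq_card_imp_inj_on)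
  then show thesis using that C(1) by blast
qed

text \<open>Every new part lies in an old one and no firm loses, so each new comparison follows from
  an old one. This serves both for dropping workers and for rotating parts.\<close>

lemma EFX_plus_improve:
  assumes mk: "market m n a" and \<gamma>: "0 \<le> \<gamma>" and efx: "EFX_plus m a \<gamma> (part n \<sigma>)"
    and imp: "\<And>i. i \<in> {1..m} \<Longrightarrow> val a i (part n \<sigma> i) \<le> val a i (part n \<tau> i)"
    and sub: "\<And>k. k \<in> {1..m} \<Longrightarrow> \<exists>l\<in>{1..m}. part n \<tau> k \<subseteq> part n \<sigma> l"
  shows "EFX_plus m a \<gamma> (part n \<tau>)"
  unfolding EFX_plus_def
proof (intro ballI impI)
  fix i k g assume i: "i \<in> {1..m}" and k: "k \<in> {1..m}" and g: "g \<in> part n \<tau> k" "0 < a i g"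
  from sub[OF k] obtain l where l: "l \<in> {1..m}" "part n \<tau> k \<subseteq> part n \<sigma> l" by blast
  have "\<gamma> * val a i (part n \<tau> k - {g}) \<le> \<gamma> * val a i (part n \<sigma> l - {g})"
    using l(2) part_subset[of n \<sigma> l] by (intro mult_left_mono val_mono[OF mk i] \<gamma>) blast+
  also have "\<dots> \<le> val a i (part n \<sigma> i)"
    using efx i l g unfolding EFX_plus_def by blast
  also note imp[OF i]
  finally show "\<gamma> * val a i (part n \<tau> k - {g}) \<le> val a i (part n \<tau> i)" .
qed

text \<open>In a partial assignment, the value 0 marks an unassigned worker.\<close>

definition welfare :: "nat \<Rightarrow> nat \<Rightarrow> (nat \<Rightarrow> nat \<Rightarrow> real) \<Rightarrow> (nat \<Rightarrow> nat) \<Rightarrow> real" where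
  "welfare m n a \<sigma> = (\<Sum>i\<in>{1..m}. val a i (part n \<sigma> i))"

definition partial_EFX :: "nat \<Rightarrow> nat \<Rightarrow> (nat \<Rightarrow> nat \<Rightarrow> real) \<Rightarrow> (nat \<Rightarrow> nat) \<Rightarrow> bool" where
  "partial_EFX m n a \<sigma> \<longleftrightarrow> \<sigma> \<in> {1..n} \<rightarrow> {0..m} \<and> EFX_plus m a (1/2) (part n \<sigma>)"

lemma welfare_less:
  assumes "\<And>i. i \<in> {1..m} \<Longrightarrow> val a i (part n \<sigma> i) \<le> val a i (part n \<tau> i)"
    and "i \<in> {1..m}" "val a i (part n \<sigma> i) < val a i (part n \<tau> i)"
  shows "welfare m n a \<sigma> < welfare m n a \<tau>"
  unfolding welfare_def by (rule sum_strict_mono_ex1) (use assms in auto)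

text \<open>Unassigning the workers that their firms value at 0 changes no firm's value for its own
  part and only shrinks parts, so it turns a maximizer into one with the last property.\<close>

lemma ex_partial_EFX_max_welfare:
  assumes mk: "market m n a"
  obtains \<sigma> where "partial_EFX m n a \<sigma>"
    and "\<And>\<tau>. partial_EFX m n a \<tau> \<Longrightarrow> welfare m n a \<tau> \<le> welfare m n a \<sigma>"
    and "\<And>j. j \<in> {1..n} \<Longrightarrow> \<sigma> j \<noteq> 0 \<Longrightarrow> 0 < a (\<sigma> j) j"
proof -
  define S where "S = {\<sigma> \<in> {1..n} \<rightarrow>\<^sub>E {0..m}. partial_EFX m n a \<sigma>}"
  have inS: "restrict \<tau> {1..n} \<in> S" if "partial_EFX m n a \<tau>" for \<tau>
    using that unfolding S_def partial_EFX_def by (auto simp: Pi_iff)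
  \<comment> \<open>With all workers unassigned every firm has the empty part; the unassigned
    workers form the part of 0, which is not a firm.\<close>
  have "partial_EFX m n a (\<lambda>_. 0)"
    by (auto simp: partial_EFX_def EFX_plus_def part_def)
  from inS[OF this] have "S \<noteq> {}" by blast
  moreover have "finite S"
    unfolding S_def by (rule finite_subset[of _ "{1..n} \<rightarrow>\<^sub>E {0..m}"]) (auto intro!: finite_PiE)
  ultimately obtain \<sigma> where \<sigma>: "\<sigma> \<in> S" "\<And>\<tau>. \<tau> \<in> S \<Longrightarrow> welfare m n a \<tau> \<le> welfare m n a \<sigma>"
    using arg_min_if_finite(1)[of S "\<lambda>\<sigma>. - welfare m n a \<sigma>"]
      arg_min_least[of S _ "\<lambda>\<sigma>. - welfare m n a \<sigma>"] by (metis neg_le_iff_le)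
  have max: "welfare m n a \<tau> \<le> welfare m n a \<sigma>" if "partial_EFX m n a \<tau>" for \<tau>
    using \<sigma>(2)[OF inS[OF that]] by (simp add: welfare_def)
  have p: "partial_EFX m n a \<sigma>" using \<sigma>(1) by (simp add: S_def)
  \<comment> \<open>An unassigned worker stays unassigned, since both branches are 0 when
    \<open>\<sigma> j = 0\<close>.\<close>
  define \<tau> where "\<tau> j = (if 0 < a (\<sigma> j) j then \<sigma> j else 0)" for j
  have part: "part n \<tau> i = {j \<in> part n \<sigma> i. 0 < a i j}" if "i \<in> {1..m}" for i
    using that by (auto simp: part_def \<tau>_def)
  have own: "val a i (part n \<tau> i) = val a i (part n \<sigma> i)" if "i \<in> {1..m}" for i
    unfolding val_def part[OF that]
  proof (rule sum.mono_neutral_left)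
    show "\<forall>j\<in>part n \<sigma> i - {j \<in> part n \<sigma> i. 0 < a i j}. a i j = 0"
      using market_nonneg[OF mk that] by (force simp: part_def)
  qed auto
  have "EFX_plus m a (1/2) (part n \<tau>)"
  proof (rule EFX_plus_improve[OF mk])
    show "EFX_plus m a (1/2) (part n \<sigma>)" using p by (simp add: partial_EFX_def)
    show "\<exists>l\<in>{1..m}. part n \<tau> k \<subseteq> part n \<sigma> l" if "k \<in> {1..m}" for k
      using part[OF that] that by blast
  qed (simp_all add: own)
  then have "partial_EFX m n a \<tau>"
    using p by (auto simp: partial_EFX_def \<tau>_def Pi_iff)
  moreover have "welfare m n a \<tau> = welfare m n a \<sigma>"
    unfolding welfare_def using own by simp
  moreover have "0 < a (\<tau> j) j" if "\<tau> j \<noteq> 0" for j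
    using that by (auto simp: \<tau>_def split: if_splits)
  ultimately show thesis
    using that[of \<tau>] max by simp
qed

lemma partial_EFX_max_assigns:
  assumes mk: "market m n a" and p: "partial_EFX m n a \<sigma>"
    and max: "\<And>\<tau>. partial_EFX m n a \<tau> \<Longrightarrow> welfare m n a \<tau> \<le> welfare m n a \<sigma>"
    and g: "g \<in> {1..n}" "\<sigma> g = 0" and i0: "i0 \<in> {1..m}"
  shows "a i0 g = 0"
proof (rule ccontr)
  assume "a i0 g \<noteq> 0"
  define L where "L = {i \<in> {1..m}. 0 < a i g}"
  have "i0 \<in> L" using \<open>a i0 g \<noteq> 0\<close> market_nonneg[OF mk i0 g(1)] i0 by (simp add: L_def)
  have finL: "finite L" and Lm: "L \<subseteq> {1..m}" by (auto simp: L_def)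
  let ?V = "\<lambda>i k. val a i (part n \<sigma> k)"
  have efx: "EFX_plus m a (1/2) (part n \<sigma>)" and rng: "\<sigma> \<in> {1..n} \<rightarrow> {0..m}"
    using p by (auto simp: partial_EFX_def)
  have V0: "0 \<le> ?V i k" if "i \<in> {1..m}" for i k
    using val_nonneg[OF mk that part_subset] .
  \<comment> \<open>Maximality rules out any change that keeps 1/2-EFX+, hurts no firm and strictly
    helps one.\<close>
  have contra: False
    if "\<tau> \<in> {1..n} \<rightarrow> {0..m}" "EFX_plus m a (1/2) (part n \<tau>)"
      "\<And>i. i \<in> {1..m} \<Longrightarrow> ?V i i \<le> val a i (part n \<tau> i)"
      "i \<in> {1..m}" "?V i i < val a i (part n \<tau> i)" for \<tau> i
    using max[of \<tau>] welfare_less[OF that(3-5)] that(1,2) by (simp add: partial_EFX_def)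
  consider (cycle) "\<forall>k\<in>L. \<exists>i\<in>L. ?V i i < ?V i k"
    | (source) k where "k \<in> L" "\<And>i. i \<in> L \<Longrightarrow> ?V i k \<le> ?V i i"
    by (meson not_le)
  then show False
  proof cases
    case cycle
    then obtain f where f: "\<And>k. k \<in> L \<Longrightarrow> f k \<in> L \<and> ?V (f k) (f k) < ?V (f k) k" by metis
    obtain C where C: "C \<subseteq> L" "C \<noteq> {}" "bij_betw f C C"
      using ex_bij_betw_subset[OF finL, of f] f \<open>i0 \<in> L\<close> by blast
    \<comment> \<open>The part of each firm in \<open>C\<close> passes to a firm that envies it;
      bijectivity of \<open>f\<close> makes this a permutation of the parts.\<close>
    define \<tau> where "\<tau> j = (if \<sigma> j \<in> C then f (\<sigma> j) else \<sigma> j)" for j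
    have fC: "f c \<in> C" if "c \<in> C" for c using C(3) that by (auto simp: bij_betw_def)
    have inC: "part n \<tau> (f c) = part n \<sigma> c" if "c \<in> C" for c
      using that fC C(3) by (auto simp: part_def \<tau>_def bij_betw_def inj_on_def)
    have outC: "part n \<tau> i = part n \<sigma> i" if "i \<notin> C" for i
      using that fC by (auto simp: part_def \<tau>_def)
    have cases: "(\<exists>c\<in>C. i = f c) \<or> i \<notin> C" for i
      using C(3) by (auto simp: bij_betw_def)
    have imp: "?V i i \<le> val a i (part n \<tau> i)" for i
      using cases[of i] inC outC f C(1) by (force simp: less_imp_le)
    obtain c where c: "c \<in> C" using C(2) by blast
    show False
    proof (rule contra)
      show "\<tau> \<in> {1..n} \<rightarrow> {0..m}"
        using rng fC C(1) Lm by (fastforce simp: \<tau>_def Pi_iff)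
      show "EFX_plus m a (1/2) (part n \<tau>)"
      proof (rule EFX_plus_improve[OF mk _ efx imp])
        show "\<exists>l\<in>{1..m}. part n \<tau> k \<subseteq> part n \<sigma> l" if "k \<in> {1..m}" for k
          using cases[of k] inC outC C(1) Lm that by blast
      qed simp
      show "?V i i \<le> val a i (part n \<tau> i)" for i by (rule imp)
      show "f c \<in> {1..m}" using c fC C(1) Lm by blast
      show "?V (f c) (f c) < val a (f c) (part n \<tau> (f c))"
        using inC[OF c] f c C(1) by auto
    qed
  next
    case (source k)
    have km: "k \<in> {1..m}" using source Lm by blast
    show False
    proof (cases "\<exists>i\<in>L. ?V i i < a i g")
      case True
      then obtain i where i: "i \<in> {1..m}" "?V i i < a i g" using Lm by blast
      \<comment> \<open>The former workers of \<open>i\<close> are released, marked by 0. The new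
        part \<open>{g}\<close> is empty after a removal, so it causes no envy.\<close>
      define \<tau> where "\<tau> j = (if j = g then i else if \<sigma> j = i then 0 else \<sigma> j)" for j
      have pi: "part n \<tau> i = {g}" using g i by (auto simp: part_def \<tau>_def)
      have po: "part n \<tau> l = part n \<sigma> l" if "l \<noteq> i" "l \<in> {1..m}" for l
        using that g by (auto simp: part_def \<tau>_def)
      have vi: "?V i i < val a i (part n \<tau> i)" using i(2) pi by (simp add: val_def)
      have imp: "?V l l \<le> val a l (part n \<tau> l)" if "l \<in> {1..m}" for l
        using vi po[OF _ that] by (cases "l = i") auto
      show False
      proof (rule contra[OF _ _ imp i(1) vi])
        show "\<tau> \<in> {1..n} \<rightarrow> {0..m}" using rng i by (auto simp: \<tau>_def Pi_iff)
        show "EFX_plus m a (1/2) (part n \<tau>)"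
          unfolding EFX_plus_def
        proof (intro ballI impI)
          fix l q h assume l: "l \<in> {1..m}" and q: "q \<in> {1..m}"
            and h: "h \<in> part n \<tau> q" "0 < a l h"
          show "1/2 * val a l (part n \<tau> q - {h}) \<le> val a l (part n \<tau> l)"
          proof (cases "q = i")
            case True
            then have "val a l (part n \<tau> q - {h}) = 0" using pi h by (simp add: val_def)
            then show ?thesis using V0[OF l, of l] imp[OF l] by simp
          next
            case False
            then have "1/2 * val a l (part n \<tau> q - {h}) \<le> ?V l l"
              using efx l q h po unfolding EFX_plus_def by simp
            then show ?thesis using imp[OF l] by simp
          qed
        qed
      qed
    next
      case False
      define \<tau> where "\<tau> = \<sigma>(g := k)"
      have pk: "part n \<tau> k = insert g (part n \<sigma> k)" "g \<notin> part n \<sigma> k"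
        using g km by (auto simp: part_def \<tau>_def)
      have po: "part n \<tau> l = part n \<sigma> l" if "l \<noteq> k" "l \<in> {1..m}" for l
        using that g by (auto simp: part_def \<tau>_def)
      have vk: "val a l (part n \<tau> k) = ?V l k + a l g" for l
        using pk by (simp add: val_def)
      have vk': "?V k k < val a k (part n \<tau> k)"
        using vk source(1) by (simp add: L_def)
      have imp: "?V l l \<le> val a l (part n \<tau> l)" if "l \<in> {1..m}" for l
        using vk' po[OF _ that] by (cases "l = k") auto
      show False
      proof (rule contra[OF _ _ imp km vk'])
        show "\<tau> \<in> {1..n} \<rightarrow> {0..m}" using rng km by (auto simp: \<tau>_def Pi_iff)
        show "EFX_plus m a (1/2) (part n \<tau>)"
          unfolding EFX_plus_def
        proof (intro ballI impI)
          fix l q h assume l: "l \<in> {1..m}" and q: "q \<in> {1..m}"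
            and h: "h \<in> part n \<tau> q" "0 < a l h"
          have "1/2 * val a l (part n \<tau> q - {h}) \<le> ?V l l"
          proof (cases "q = k")
            case True
            show ?thesis
            proof (cases "0 < a l g")
              case lg: True
              then have lL: "l \<in> L" using l by (simp add: L_def)
              have "val a l (part n \<tau> k - {h}) \<le> val a l (part n \<tau> k)"
                using part_subset by (intro val_mono[OF mk l]) auto
              \<comment> \<open>The factor 1/2 originates here: firm \<open>l\<close> does not envy
                the old part of \<open>k\<close> and does not prefer \<open>g\<close> alone, so each
                of the two is worth at most its own part.\<close>
              also have "\<dots> \<le> ?V l l + ?V l l"
                using vk source(2)[OF lL] False lL by (force simp: not_less)
              finally show ?thesis using True by simp
            next
              \<comment> \<open>A firm outside \<open>L\<close> values \<open>g\<close> at 0, so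
                \<open>h\<close> differs from \<open>g\<close> and the old comparison with
                \<open>k\<close> carries over.\<close>
              case lg: False
              then have z: "a l g = 0" using market_nonneg[OF mk l g(1)] by simp
              with h have "h \<noteq> g" by auto
              then have hk: "h \<in> part n \<sigma> k" using h True pk by simp
              have "part n \<tau> k - {h} = insert g (part n \<sigma> k - {h})"
                using pk \<open>h \<noteq> g\<close> by auto
              then have "val a l (part n \<tau> k - {h}) = val a l (part n \<sigma> k - {h})"
                using pk(2) z by (simp add: val_def)
              then show ?thesis using efx l km hk h True unfolding EFX_plus_def by simp
            qed
          next
            case False
            then show ?thesis using efx l q h po unfolding EFX_plus_def by simp
          qed
          then show "1/2 * val a l (part n \<tau> q - {h}) \<le> val a l (part n \<tau> l)"
            using imp[OF l] by simp
        qed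
      qed
    qed
  qed
qed

text \<open>A welfare maximizer leaves unassigned only workers worth 0 to every firm. Giving them
  all to firm 1 completes the assignment without changing any value.\<close>

lemma ex_supported_EFX_plus_half:
  assumes mk: "market m n a"
  shows "\<exists>\<sigma>. supported m n a \<sigma> \<and> EFX_plus m a (1/2) (part n \<sigma>)"
proof -
  obtain \<sigma> where p: "partial_EFX m n a \<sigma>"
    and max: "\<And>\<tau>. partial_EFX m n a \<tau> \<Longrightarrow> welfare m n a \<tau> \<le> welfare m n a \<sigma>"
    and pos: "\<And>j. j \<in> {1..n} \<Longrightarrow> \<sigma> j \<noteq> 0 \<Longrightarrow> 0 < a (\<sigma> j) j"
    using ex_partial_EFX_max_welfare[OF mk] by blast
  have zero: "a i j = 0" if "j \<in> {1..n}" "\<sigma> j = 0" "i \<in> {1..m}" for i j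
    using partial_EFX_max_assigns[OF mk p max that] .
  define \<tau> where "\<tau> j = (if \<sigma> j = 0 then 1 else \<sigma> j)" for j
  have "1 \<le> m" using mk by (simp add: market_def)
  have "supported m n a \<tau>"
    unfolding supported_def
  proof (intro conjI ballI impI)
    show "\<tau> \<in> {1..n} \<rightarrow> {1..m}"
      using p \<open>1 \<le> m\<close> by (auto simp: partial_EFX_def \<tau>_def Pi_iff)
    show "0 < a (\<tau> j) j" if "j \<in> {1..n}" "i \<in> {1..m}" "0 < a i j" for i j
      using that zero[of j i] pos[of j] by (auto simp: \<tau>_def)
  qed
  moreover have "EFX_plus m a (1/2) (part n \<tau>)"
    unfolding EFX_plus_def
  proof (intro ballI impI)
    fix i k g assume i: "i \<in> {1..m}" and k: "k \<in> {1..m}" and g: "g \<in> part n \<tau> k" "0 < a i g"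
    have sub: "part n \<sigma> l \<subseteq> part n \<tau> l" if "l \<in> {1..m}" for l
      using that by (auto simp: part_def \<tau>_def)
    have z: "a i j = 0" if "j \<in> part n \<tau> l - part n \<sigma> l" for j l
      using that zero[of j i] i by (auto simp: part_def \<tau>_def split: if_splits)
    \<comment> \<open>A worker that \<open>i\<close> values is not among the added ones, so its
      removal is covered by the partial assignment.\<close>
    have "g \<in> part n \<sigma> k" using g z[of g k] by fastforce
    then have "1/2 * val a i (part n \<sigma> k - {g}) \<le> val a i (part n \<sigma> i)"
      using p i k g unfolding partial_EFX_def EFX_plus_def by blast
    moreover have "val a i (part n \<sigma> k - {g}) = val a i (part n \<tau> k - {g})"
      unfolding val_def using sub[OF k] z[of _ k] by (intro sum.mono_neutral_left) auto
    moreover have "val a i (part n \<sigma> i) = val a i (part n \<tau> i)"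
      unfolding val_def using sub[OF i] z[of _ i] by (intro sum.mono_neutral_left) auto
    ultimately show "1/2 * val a i (part n \<tau> k - {g}) \<le> val a i (part n \<tau> i)" by simp
  qed
  ultimately show ?thesis by blast
qed

section \<open>The bounds on the frontier\<close>

theorem theorem13:
  shows "(\<forall>\<delta>::real. 0 < \<delta> \<and> \<delta> \<le> 1 \<longrightarrow> frontier_EFX_plus \<delta> \<ge> max \<delta> (1/2))
         \<and> frontier_EFX_plus 1 = 1"
proof -
  define R where "R m n a \<delta> = Max (EFX_plus_level m a `
    {X. complete_matching m n X \<and> ennreal \<delta> \<le> core_level m n a X})" for m n a \<delta>
  define Q where "Q \<delta> = {R m n a \<delta> | m n a. market m n a \<and> \<delta> \<le> market_delta m n a}" for \<delta>
  have frontier: "frontier_EFX_plus \<delta> = Inf (Q \<delta>)" for \<delta>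
    by (simp add: frontier_EFX_plus_def Q_def R_def)
  have ge: "max \<delta> (1/2) \<le> R m n a \<delta>"
    if \<delta>: "0 < \<delta>" "\<delta> \<le> 1" and mk: "market m n a" "\<delta> \<le> market_delta m n a" for m n a \<delta>
  proof -
    obtain \<sigma> where "supported m n a \<sigma>" "EFX_plus m a \<delta> (part n \<sigma>)"
      using ex_supported_EFX_plus_delta[OF mk \<delta>] by blast
    then have "\<delta> \<le> R m n a \<delta>"
      unfolding R_def using mk \<delta> by (intro supported_le_Max) auto
    moreover obtain \<tau> where "supported m n a \<tau>" "EFX_plus m a (1/2) (part n \<tau>)"
      using ex_supported_EFX_plus_half[OF mk(1)] by blast
    then have "1/2 \<le> R m n a \<delta>"
      unfolding R_def using mk \<delta> by (intro supported_le_Max) auto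
    ultimately show ?thesis by simp
  qed
  \<comment> \<open>The market with one firm and no workers is admissible for every \<delta> \<le>
    1. It makes the infimum one over a nonempty set and gives the upper bound at \<delta> =
    1.\<close>
  have null: "market 1 0 (\<lambda>_ _. 0)" "market_delta 1 0 (\<lambda>_ _. 0) = 1"
    by (simp_all add: market_def market_delta_def)
  have inQ: "R 1 0 (\<lambda>_ _. 0) \<delta> \<in> Q \<delta>" if "\<delta> \<le> 1" for \<delta>
    unfolding Q_def using null that by force
  have lower: "max \<delta> (1/2) \<le> frontier_EFX_plus \<delta>" if "0 < \<delta>" "\<delta> \<le> 1" for \<delta>
    unfolding frontier
  proof (rule cInf_greatest)
    show "Q \<delta> \<noteq> {}" using inQ[OF that(2)] by blast
    show "max \<delta> (1/2) \<le> r" if "r \<in> Q \<delta>" for r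
      using that ge[OF \<open>0 < \<delta>\<close> \<open>\<delta> \<le> 1\<close>] by (auto simp: Q_def)
  qed
  have "frontier_EFX_plus 1 \<le> R 1 0 (\<lambda>_ _. 0) 1"
    unfolding frontier
  proof (rule cInf_lower)
    show "R 1 0 (\<lambda>_ _. 0) 1 \<in> Q 1" by (rule inQ) simp
    show "bdd_below (Q 1)"
      using ge[of 1] by (intro bdd_belowI[of _ "max 1 (1/2)"]) (auto simp: Q_def)
  qed
  also have "\<dots> \<le> 1"
  proof -
    let ?a = "\<lambda>_ _. 0 :: real"
    let ?A = "{X. complete_matching 1 0 X \<and> ennreal 1 \<le> core_level 1 0 ?a X}"
    \<comment> \<open>Bounding the maximum from above requires an admissible matching to
      exist.\<close>
    have "supported 1 0 ?a (\<lambda>_. 1)" by (simp add: supported_def)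
    then have "restrict (part 0 (\<lambda>_. 1)) {1..1} \<in> ?A"
      using complete_matching_part[of "\<lambda>_. 1" 0 1] supported_core_level[OF null(1), of 1] null(2)
      by simp
    then have "?A \<noteq> {}" by blast
    moreover have "finite ?A"
      by (rule finite_subset[OF _ finite_complete_matchings[of 1 0]]) auto
    moreover have "EFX_plus_level 1 ?a X \<le> 1" for X
    proof -
      \<comment> \<open>The level 0 keeps the supremum over a nonempty subset of the unit
        interval.\<close>
      have "EFX_plus 1 ?a 0 X" by (simp add: EFX_plus_def)
      then show ?thesis unfolding EFX_plus_level_def by (intro cSup_least) force+
    qed
    ultimately show ?thesis unfolding R_def by (subst Max_le_iff) auto
  qed
  finally show ?thesis using lower lower[of 1] by force
qed

end
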